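(* Let $G=(X,Y,E)$ be a chained complete bipartite graph with MCB-component family $\mathscr{C}=\{C_1,\dots,C_n\}$ labelled as in the definition. Then $$I(G)= \sum_{i=1}^{n}\Big(|X_i|\cdot|Y_i|+(|X_i|\bmod 2)\cdot(|Y_i|\bmod 2)\Big)-\sum_{i=1}^{n-1}\big(g(s_i,C_i)+g(s_i,C_{i+1})\big)+\sum_{i=1}^{n-1}\big|g(s_i,C_i)-g(s_i,C_{i+1})\big|.$$
   Context: All graphs are finite, simple, undirected and connected. For a graph $G=(V,E)$ and an ordering (bijection) $\sigma:V\to\{1,\dots,|V|\}$, $I(v,\sigma,G)=\big|\,|\{u\in N(v): \sigma(u)<\sigma(v)\}|-|\{u\in N(v): \sigma(u)>\sigma(v)\}|\,\big|$, $I(\sigma,G)=\sum_v I(v,\sigma,G)$, $I(G)=\min_\sigma I(\sigma,G)$. An MCB-component family of $G$ is a family $\mathscr{C}$ of vertex subsets such that every edge lies within some $C\in\mathscr{C}$, each $G[C]$ is complete bipartite, and for each $C\in\mathscr{C}$ and $v\notin C$, $G[C\cup\{v\}]$ is not complete bipartite. A bipartite graph $G=(X,Y,E)$ is a chained complete bipartite graph if it has an MCB-component family labelled $\mathscr{C}=\{C_1,\dots,C_n\}$ with $|C_i\cap C_{i+1}|=1$ for $1\le i<n$ and $C_i\cap C_j=\emptyset$ whenever $|i-j|>1$. The unique vertex of $C_i\cap C_{i+1}$ is denoted $s_i$. $X_i=X\cap C_i$, $Y_i=Y\cap C_i$. $g(s_i,C_j)=|N(s_i)\cap C_j|$, equal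 to $|Y_j|$ if $s_i\in X$ and $|X_j|$ if $s_i\in Y$. *)

theory Defs
  imports "Graph_Theory.Kuratowski"
begin

text \<open>
  Finite simple undirected graphs are modelled as in the Graph Theory library: the locale
  \<open>graph\<close> of finite symmetric digraphs without loops and without parallel arcs.
\<close>

definition neighbours :: "('a,'b) pre_digraph \<Rightarrow> 'a \<Rightarrow> 'a set" where
  "neighbours G v = {u. v \<rightarrow>\<^bsub>G\<^esub> u}"

definition ordering :: "('a,'b) pre_digraph \<Rightarrow> ('a \<Rightarrow> nat) \<Rightarrow> bool" where
  "ordering G \<sigma> \<longleftrightarrow> bij_betw \<sigma> (verts G) {1..card (verts G)}"

definition vertex_imbalance :: "'a \<Rightarrow> ('a \<Rightarrow> nat) \<Rightarrow> ('a,'b) pre_digraph \<Rightarrow> int" where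
  "vertex_imbalance v \<sigma> G =
     \<bar>int (card {u \<in> neighbours G v. \<sigma> u < \<sigma> v}) - int (card {u \<in> neighbours G v. \<sigma> u > \<sigma> v})\<bar>"

definition ordering_imbalance :: "('a \<Rightarrow> nat) \<Rightarrow> ('a,'b) pre_digraph \<Rightarrow> int" where
  "ordering_imbalance \<sigma> G = (\<Sum>v\<in>verts G. vertex_imbalance v \<sigma> G)"

definition imbalance :: "('a,'b) pre_digraph \<Rightarrow> int" where
  "imbalance G = Min {ordering_imbalance \<sigma> G | \<sigma>. ordering G \<sigma>}"

text \<open>
  Orderings are unconstrained outside the vertex set, so there may be infinitely many of them;
  the next two facts show that the minimum above is nevertheless a genuine one.
\<close>

lemma (in graph) finite_ordering_imbalances:
  "finite {ordering_imbalance \<sigma> G | \<sigma>. ordering G \<sigma>}"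
proof (rule finite_subset)
  let ?N = "int (card (verts G))"
  have sub: "neighbours G v \<subseteq> verts G" for v
    by (auto simp: neighbours_def)
  have fin: "finite (neighbours G v)" for v
    using finite_subset[OF sub finite_verts] .
  have le: "card {u \<in> neighbours G v. P u} \<le> card (verts G)" for v P
    by (rule card_mono[OF finite_verts]) (use sub in blast)
  have bound: "vertex_imbalance v \<sigma> G \<le> ?N" for v \<sigma>
    using le[of v "\<lambda>u. \<sigma> u < \<sigma> v"] le[of v "\<lambda>u. \<sigma> u > \<sigma> v"]
    unfolding vertex_imbalance_def by linarith
  have "ordering_imbalance \<sigma> G \<le> ?N * ?N" for \<sigma>
    unfolding ordering_imbalance_def
    using sum_bounded_above[of "verts G" "\<lambda>v. vertex_imbalance v \<sigma> G" ?N] bound by simp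
  moreover have "0 \<le> ordering_imbalance \<sigma> G" for \<sigma>
    unfolding ordering_imbalance_def by (rule sum_nonneg) (simp add: vertex_imbalance_def)
  ultimately show "{ordering_imbalance \<sigma> G | \<sigma>. ordering G \<sigma>} \<subseteq> {0..?N * ?N}"
    by auto
qed simp

lemma (in graph) ordering_exists: "\<exists>\<sigma>. ordering G \<sigma>"
  unfolding ordering_def by (rule finite_same_card_bij) simp_all

definition bipartition :: "('a,'b) pre_digraph \<Rightarrow> 'a set \<Rightarrow> 'a set \<Rightarrow> bool" where
  "bipartition G X Y \<longleftrightarrow> X \<union> Y = verts G \<and> X \<inter> Y = {} \<and>
     (\<forall>u v. u \<rightarrow>\<^bsub>G\<^esub> v \<longrightarrow> u \<in> X \<and> v \<in> Y \<or> u \<in> Y \<and> v \<in> X)"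

text \<open>
  One of the two sides may be empty. This matters only for edgeless vertex sets; in a connected
  graph with at least two vertices these never occur in a chained family below.
\<close>

definition complete_bipartite :: "('a,'b) pre_digraph \<Rightarrow> bool" where
  "complete_bipartite G \<longleftrightarrow> (\<exists>m n. K\<^bsub>m,n\<^esub> G)"

definition mcb_component_family :: "('a,'b) pre_digraph \<Rightarrow> 'a set set \<Rightarrow> bool" where
  "mcb_component_family G \<C> \<longleftrightarrow>
     (\<forall>C\<in>\<C>. C \<subseteq> verts G) \<and>
     (\<forall>u v. u \<rightarrow>\<^bsub>G\<^esub> v \<longrightarrow> (\<exists>C\<in>\<C>. u \<in> C \<and> v \<in> C)) \<and>
     (\<forall>C\<in>\<C>. complete_bipartite (G \<restriction> C)) \<and>
     (\<forall>C\<in>\<C>. \<forall>v \<in> verts G - C. \<not> complete_bipartite (G \<restriction> (C \<union> {v})))"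

definition chain_labelling :: "'a set set \<Rightarrow> nat \<Rightarrow> (nat \<Rightarrow> 'a set) \<Rightarrow> bool" where
  "chain_labelling \<C> n C \<longleftrightarrow>
     bij_betw C {1..n} \<C> \<and>
     (\<forall>i\<in>{1..<n}. card (C i \<inter> C (i + 1)) = 1) \<and>
     (\<forall>i\<in>{1..n}. \<forall>j\<in>{1..n}. \<bar>int i - int j\<bar> > 1 \<longrightarrow> C i \<inter> C j = {})"

definition chained_complete_bipartite ::
  "('a,'b) pre_digraph \<Rightarrow> 'a set \<Rightarrow> 'a set \<Rightarrow> 'a set set \<Rightarrow> nat \<Rightarrow> (nat \<Rightarrow> 'a set) \<Rightarrow> bool" where
  "chained_complete_bipartite G X Y \<C> n C \<longleftrightarrow>
     bipartition G X Y \<and> mcb_component_family G \<C> \<and> chain_labelling \<C> n C"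

definition link_vertex :: "(nat \<Rightarrow> 'a set) \<Rightarrow> nat \<Rightarrow> 'a" where
  "link_vertex C i = the_elem (C i \<inter> C (i + 1))"

definition degree_into :: "('a,'b) pre_digraph \<Rightarrow> 'a \<Rightarrow> 'a set \<Rightarrow> nat" where
  "degree_into G s D = card (neighbours G s \<inter> D)"

end

theory Submission
  imports Defs
begin

text \<open>
  Every edge lies in exactly one block \<open>C i\<close>, so the imbalance of an ordering is the sum of its
  imbalances on the blocks, corrected at each link vertex by \<open>\<bar>a + b\<bar> - \<bar>a\<bar> - \<bar>b\<bar>\<close>, where \<open>a\<close> and \<open>b\<close>
  are the signed imbalances of the link in its two blocks. If \<open>\<bar>a\<bar> \<le> g\<close> and \<open>\<bar>b\<bar> \<le> h\<close>, this
  correction is at least \<open>\<bar>g - h\<bar> - g - h\<close>, so lower bounds for the single blocks, which are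
  complete bipartite, suffice. Conversely, maximality of the blocks forces a link not to be alone on
  its side of a block, and this makes it possible to order each block optimally with its incoming
  link before, and its outgoing link after, all their neighbours. Concatenating the block orders
  attains every bound at once.
\<close>

section \<open>Complete bipartite graphs\<close>

definition signed_imbalance :: "('a \<Rightarrow> nat) \<Rightarrow> 'a set \<Rightarrow> 'a \<Rightarrow> int" where
  "signed_imbalance \<sigma> S v = (\<Sum>u\<in>S. sgn (int (\<sigma> v) - int (\<sigma> u)))"

lemma signed_imbalance_eq_card_diff:
  assumes "finite S"
  shows "signed_imbalance \<sigma> S v = int (card {u \<in> S. \<sigma> u < \<sigma> v}) - int (card {u \<in> S. \<sigma> u > \<sigma> v})"
proof -
  have "signed_imbalance \<sigma> S v =
      (\<Sum>u\<in>S. (if \<sigma> u < \<sigma> v then 1 else 0) - (if \<sigma> u > \<sigma> v then 1 else 0))"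
    unfolding signed_imbalance_def by (rule sum.cong) (auto simp: sgn_if)
  also have "\<dots> = int (card {u \<in> S. \<sigma> u < \<sigma> v}) - int (card {u \<in> S. \<sigma> u > \<sigma> v})"
    using assms by (simp add: sum_subtractf flip: sum.inter_filter)
  finally show ?thesis .
qed

lemma abs_signed_imbalance_le: "\<bar>signed_imbalance \<sigma> S v\<bar> \<le> int (card S)"
proof -
  have "\<bar>signed_imbalance \<sigma> S v\<bar> \<le> (\<Sum>u\<in>S. \<bar>sgn (int (\<sigma> v) - int (\<sigma> u))\<bar>)"
    unfolding signed_imbalance_def by (rule sum_abs)
  also have "\<dots> \<le> (\<Sum>u\<in>S. 1)"
    by (rule sum_mono) (simp add: abs_sgn_eq)
  finally show ?thesis by simp
qed

lemma signed_imbalance_cong: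
  assumes "\<And>u. u \<in> S \<Longrightarrow> \<sigma> u < \<sigma> v \<longleftrightarrow> \<tau> u < \<tau> v"
    and "\<And>u. u \<in> S \<Longrightarrow> \<sigma> v < \<sigma> u \<longleftrightarrow> \<tau> v < \<tau> u"
  shows "signed_imbalance \<sigma> S v = signed_imbalance \<tau> S v"
  unfolding signed_imbalance_def
proof (rule sum.cong)
  fix u assume "u \<in> S"
  with assms[of u] show "sgn (int (\<sigma> v) - int (\<sigma> u)) = sgn (int (\<tau> v) - int (\<tau> u))"
    by (auto simp: sgn_if)
qed simp

lemma signed_imbalance_last: "(\<And>u. u \<in> S \<Longrightarrow> \<sigma> u < \<sigma> v) \<Longrightarrow> signed_imbalance \<sigma> S v = int (card S)"
  by (simp add: signed_imbalance_def)

lemma signed_imbalance_first: "(\<And>u. u \<in> S \<Longrightarrow> \<sigma> v < \<sigma> u) \<Longrightarrow> signed_imbalance \<sigma> S v = - int (card S)"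
  by (simp add: signed_imbalance_def)

lemma signed_imbalance_strict_mono:
  assumes "finite S" and "\<sigma> u < \<sigma> v" and "u \<in> S \<or> v \<in> S"
  shows "signed_imbalance \<sigma> S u < signed_imbalance \<sigma> S v"
  unfolding signed_imbalance_def
proof (rule sum_strict_mono_ex1)
  show "\<forall>w\<in>S. sgn (int (\<sigma> u) - int (\<sigma> w)) \<le> sgn (int (\<sigma> v) - int (\<sigma> w))"
    using assms(2) by (auto simp: sgn_if)
  show "\<exists>w\<in>S. sgn (int (\<sigma> u) - int (\<sigma> w)) < sgn (int (\<sigma> v) - int (\<sigma> w))"
    using assms(2,3) by (auto simp: sgn_if intro: bexI[of _ u] bexI[of _ v])
qed fact

lemma odd_signed_imbalance_iff:
  assumes "finite S" and "\<And>u. u \<in> S \<Longrightarrow> \<sigma> u \<noteq> \<sigma> v"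
  shows "odd (signed_imbalance \<sigma> S v) \<longleftrightarrow> odd (card S)"
proof -
  have "odd (sgn (int (\<sigma> v) - int (\<sigma> u)))" if "u \<in> S" for u
    using assms(2)[OF that] by (cases "\<sigma> u < \<sigma> v") auto
  then have "{u \<in> S. odd (sgn (int (\<sigma> v) - int (\<sigma> u)))} = S" by auto
  then show ?thesis
    unfolding signed_imbalance_def by (simp add: even_sum_iff[OF assms(1)])
qed

lemma bij_betw_rank:
  fixes \<sigma> :: "'a \<Rightarrow> nat"
  assumes "finite A" and "inj_on \<sigma> A"
  shows "bij_betw (\<lambda>x. card {u \<in> A. \<sigma> u < \<sigma> x}) A {..<card A}"
proof -
  let ?r = "\<lambda>x. card {u \<in> A. \<sigma> u < \<sigma> x}"
  have less: "?r x < ?r y" if "x \<in> A" "y \<in> A" "\<sigma> x < \<sigma> y" for x y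
    by (rule psubset_card_mono) (use assms(1) that in auto)
  have inj: "inj_on ?r A"
  proof (rule inj_onI)
    fix x y assume "x \<in> A" "y \<in> A" "?r x = ?r y"
    then have "\<sigma> x = \<sigma> y" using less[of x y] less[of y x] by (metis less_irrefl nat_neq_iff)
    then show "x = y" using assms(2) \<open>x \<in> A\<close> \<open>y \<in> A\<close> by (auto dest: inj_onD)
  qed
  have "?r x < card A" if "x \<in> A" for x
    by (rule psubset_card_mono) (use assms(1) that in auto)
  then have "?r ` A \<subseteq> {..<card A}" by auto
  then have "?r ` A = {..<card A}"
    using inj by (intro card_subset_eq) (simp_all add: card_image)
  with inj show ?thesis by (simp add: bij_betw_def)
qed

lemma sum_sgn_signed_imbalance:
  assumes "finite A" and "inj_on \<sigma> A"
  shows "(\<Sum>x\<in>A. sgn (signed_imbalance \<sigma> A x)) = 0"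
proof -
  let ?r = "\<lambda>x. card {u \<in> A. \<sigma> u < \<sigma> x}"
  let ?f = "\<lambda>k. sgn (2 * int k + 1 - int (card A))"
  have "signed_imbalance \<sigma> A x = 2 * int (?r x) + 1 - int (card A)" if "x \<in> A" for x
  proof -
    have "A = {u \<in> A. \<sigma> u < \<sigma> x} \<union> {u \<in> A. \<sigma> u > \<sigma> x} \<union> {x}"
      using inj_onD[OF assms(2) _ that] that by (auto simp: not_less_iff_gr_or_eq)
    then have "card A = card ({u \<in> A. \<sigma> u < \<sigma> x} \<union> {u \<in> A. \<sigma> u > \<sigma> x} \<union> {x})" by simp
    also have "\<dots> = ?r x + card {u \<in> A. \<sigma> u > \<sigma> x} + 1"
      using assms(1) by (subst card_Un_disjoint, auto)+
    finally show ?thesis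
      by (simp add: signed_imbalance_eq_card_diff[OF assms(1)])
  qed
  then have "(\<Sum>x\<in>A. sgn (signed_imbalance \<sigma> A x)) = (\<Sum>x\<in>A. ?f (?r x))" by simp
  also have "\<dots> = (\<Sum>k<card A. ?f k)"
    by (rule sum.reindex_bij_betw[OF bij_betw_rank[OF assms]])
  finally have eq: "(\<Sum>x\<in>A. sgn (signed_imbalance \<sigma> A x)) = (\<Sum>k<card A. ?f k)" .
  have "(\<Sum>k<card A. ?f k) = (\<Sum>k<card A. ?f (card A - Suc k))"
    by (rule sum.nat_diff_reindex[symmetric])
  also have "\<dots> = (\<Sum>k<card A. - ?f k)"
    by (rule sum.cong) (auto simp: of_nat_diff sgn_if)
  finally show ?thesis by (simp add: eq sum_negf)
qed

definition biclique_imbalance :: "('a \<Rightarrow> nat) \<Rightarrow> 'a set \<Rightarrow> 'a set \<Rightarrow> int" where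
  "biclique_imbalance \<sigma> A B =
     (\<Sum>x\<in>A. \<bar>signed_imbalance \<sigma> B x\<bar>) + (\<Sum>y\<in>B. \<bar>signed_imbalance \<sigma> A y\<bar>)"

lemma biclique_imbalance_commute: "biclique_imbalance \<sigma> A B = biclique_imbalance \<sigma> B A"
  by (simp add: biclique_imbalance_def)

lemma biclique_imbalance_cong:
  assumes "\<And>x y. x \<in> A \<Longrightarrow> y \<in> B \<Longrightarrow> (\<sigma> x < \<sigma> y \<longleftrightarrow> \<tau> x < \<tau> y) \<and> (\<sigma> y < \<sigma> x \<longleftrightarrow> \<tau> y < \<tau> x)"
  shows "biclique_imbalance \<sigma> A B = biclique_imbalance \<tau> A B"
  unfolding biclique_imbalance_def
  using assms
  by (intro arg_cong2[where f = "(+)"] sum.cong refl arg_cong[where f = abs] signed_imbalance_cong) blast+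

definition biclique_optimum :: "nat \<Rightarrow> nat \<Rightarrow> int" where
  "biclique_optimum p q = int (p * q + (p mod 2) * (q mod 2))"

lemma biclique_optimum_commute: "biclique_optimum p q = biclique_optimum q p"
  by (simp add: biclique_optimum_def mult.commute)

text \<open>
  The signs \<open>e v\<close> mark the side of the median of \<open>A\<close> on which \<open>v\<close> lies. They balance out on
  \<open>A\<close>, and each pair \<open>(x, y)\<close> contributes at least \<open>1 - e x * e y\<close> to the sum of all
  \<open>e v\<close> times the signed imbalance of \<open>v\<close>.
\<close>

lemma biclique_imbalance_ge_prod:
  assumes fin: "finite A" "finite B" and inj: "inj_on \<sigma> (A \<union> B)" and disj: "A \<inter> B = {}"
  shows "biclique_imbalance \<sigma> A B \<ge> int (card A) * int (card B)"
proof -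
  define e where "e v = sgn (signed_imbalance \<sigma> A v)" for v
  let ?t = "\<lambda>x y. sgn (int (\<sigma> x) - int (\<sigma> y))"
  have le: "e v * d \<le> \<bar>d\<bar>" for v d by (auto simp: e_def sgn_if)
  have pair: "1 - e x * e y \<le> e x * ?t x y + e y * ?t y x" if "x \<in> A" "y \<in> B" for x y
  proof -
    have "\<sigma> x \<noteq> \<sigma> y" using inj disj that by (auto dest: inj_onD)
    then consider "\<sigma> x < \<sigma> y" | "\<sigma> y < \<sigma> x" by linarith
    then show ?thesis
    proof cases
      case 1
      then have "signed_imbalance \<sigma> A x < signed_imbalance \<sigma> A y"
        using signed_imbalance_strict_mono[OF fin(1), of \<sigma> x y] that by simp
      with 1 show ?thesis by (auto simp: e_def sgn_if)
    next
      case 2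
      then have "signed_imbalance \<sigma> A y < signed_imbalance \<sigma> A x"
        using signed_imbalance_strict_mono[OF fin(1), of \<sigma> y x] that by simp
      with 2 show ?thesis by (auto simp: e_def sgn_if)
    qed
  qed
  have e0: "(\<Sum>x\<in>A. e x) = 0"
    unfolding e_def using sum_sgn_signed_imbalance[OF fin(1)] inj by (simp add: inj_on_Un)
  have "int (card A) * int (card B) = int (card A) * int (card B) - (\<Sum>x\<in>A. e x) * (\<Sum>y\<in>B. e y)"
    by (simp add: e0)
  also have "\<dots> = (\<Sum>x\<in>A. \<Sum>y\<in>B. 1 - e x * e y)"
    by (simp add: sum_product sum_subtractf)
  also have "\<dots> \<le> (\<Sum>x\<in>A. \<Sum>y\<in>B. e x * ?t x y + e y * ?t y x)"
    by (intro sum_mono pair)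
  also have "\<dots> = (\<Sum>x\<in>A. e x * signed_imbalance \<sigma> B x) + (\<Sum>y\<in>B. e y * signed_imbalance \<sigma> A y)"
    by (simp add: signed_imbalance_def sum.distrib sum_distrib_left sum.swap[of _ A B])
  also have "\<dots> \<le> biclique_imbalance \<sigma> A B"
    unfolding biclique_imbalance_def by (intro add_mono sum_mono le)
  finally show ?thesis .
qed

lemma biclique_imbalance_ge:
  assumes fin: "finite A" "finite B" and inj: "inj_on \<sigma> (A \<union> B)" and disj: "A \<inter> B = {}"
  shows "biclique_imbalance \<sigma> A B \<ge> biclique_optimum (card A) (card B)"
proof (cases "odd (card A) \<and> odd (card B)")
  case True
  have ne: "\<sigma> x \<noteq> \<sigma> y" if "x \<in> A" "y \<in> B" for x y
    using inj disj that by (auto dest: inj_onD)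
  have "odd (signed_imbalance \<sigma> B x)" if "x \<in> A" for x
    using True ne[OF that] by (subst odd_signed_imbalance_iff) (use fin in \<open>auto simp: eq_commute\<close>)
  then have "{x \<in> A. odd \<bar>signed_imbalance \<sigma> B x\<bar>} = A" by auto
  then have "odd (\<Sum>x\<in>A. \<bar>signed_imbalance \<sigma> B x\<bar>)"
    using True by (simp add: even_sum_iff[OF fin(1)])
  moreover
  have "odd (signed_imbalance \<sigma> A y)" if "y \<in> B" for y
    using True ne[OF _ that] by (subst odd_signed_imbalance_iff) (use fin in auto)
  then have "{y \<in> B. odd \<bar>signed_imbalance \<sigma> A y\<bar>} = B" by auto
  then have "odd (\<Sum>y\<in>B. \<bar>signed_imbalance \<sigma> A y\<bar>)"
    using True by (simp add: even_sum_iff[OF fin(2)])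
  ultimately have "even (biclique_imbalance \<sigma> A B)"
    by (simp add: biclique_imbalance_def)
  moreover have "odd (int (card A) * int (card B))" using True by simp
  ultimately have "biclique_imbalance \<sigma> A B \<noteq> int (card A) * int (card B)" by metis
  then show ?thesis
    using biclique_imbalance_ge_prod[OF assms] True
    by (simp add: biclique_optimum_def mod2_eq_if)
next
  case False
  then show ?thesis
    using biclique_imbalance_ge_prod[OF assms] by (auto simp: biclique_optimum_def mod2_eq_if)
qed

lemma biclique_imbalance_levels:
  fixes r :: "'a \<Rightarrow> nat"
  assumes "finite A" "finite B"
    and A: "A = A0 \<union> A2 \<union> A4" "A0 \<inter> A2 = {}" "A0 \<inter> A4 = {}" "A2 \<inter> A4 = {}"
    and B: "B = B1 \<union> B3" "B1 \<inter> B3 = {}"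
    and r: "\<And>v. v \<in> A0 \<Longrightarrow> r v = 0" "\<And>v. v \<in> B1 \<Longrightarrow> r v = 1" "\<And>v. v \<in> A2 \<Longrightarrow> r v = 2"
      "\<And>v. v \<in> B3 \<Longrightarrow> r v = 3" "\<And>v. v \<in> A4 \<Longrightarrow> r v = 4"
  shows "biclique_imbalance r A B =
    int (card A0 + card A4) * int (card B) + int (card A2) * \<bar>int (card B1) - int (card B3)\<bar>
    + int (card B1) * \<bar>int (card A0) - int (card A2) - int (card A4)\<bar>
    + int (card B3) * \<bar>int (card A0) + int (card A2) - int (card A4)\<bar>"
proof -
  have fin: "finite A0" "finite A2" "finite A4" "finite B1" "finite B3"
    using assms(1,2) unfolding A(1) B(1) by auto
  have sB: "signed_imbalance r B v = (\<Sum>u\<in>B1. sgn (int (r v) - 1)) + (\<Sum>u\<in>B3. sgn (int (r v) - 3))" for v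
    unfolding signed_imbalance_def B(1) using fin B(2) r by (simp add: sum.union_disjoint)
  have sA: "signed_imbalance r A v = (\<Sum>u\<in>A0. sgn (int (r v))) + (\<Sum>u\<in>A2. sgn (int (r v) - 2))
      + (\<Sum>u\<in>A4. sgn (int (r v) - 4))" for v
    unfolding signed_imbalance_def A(1) using fin A r
    by (subst sum.union_disjoint; (auto simp: sum.union_disjoint)?)
  have cB: "card B = card B1 + card B3" unfolding B(1) using fin B(2) by (simp add: card_Un_disjoint)
  have "(\<Sum>x\<in>A. \<bar>signed_imbalance r B x\<bar>) = (\<Sum>x\<in>A0. \<bar>signed_imbalance r B x\<bar>)
      + (\<Sum>x\<in>A2. \<bar>signed_imbalance r B x\<bar>) + (\<Sum>x\<in>A4. \<bar>signed_imbalance r B x\<bar>)"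
    unfolding A(1) using fin A
    by (subst sum.union_disjoint; (auto simp: sum.union_disjoint)?)
  also have "\<dots> = int (card A0) * int (card B) + int (card A2) * \<bar>int (card B1) - int (card B3)\<bar>
      + int (card A4) * int (card B)"
    unfolding sB using r by (simp add: cB)
  finally have 1: "(\<Sum>x\<in>A. \<bar>signed_imbalance r B x\<bar>) = \<dots>" .
  have "(\<Sum>y\<in>B. \<bar>signed_imbalance r A y\<bar>) =
      (\<Sum>y\<in>B1. \<bar>signed_imbalance r A y\<bar>) + (\<Sum>y\<in>B3. \<bar>signed_imbalance r A y\<bar>)"
    unfolding B(1) using fin B(2) by (simp add: sum.union_disjoint)
  also have "\<dots> = int (card B1) * \<bar>int (card A0) - int (card A2) - int (card A4)\<bar>
      + int (card B3) * \<bar>int (card A0) + int (card A2) - int (card A4)\<bar>"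
    unfolding sA using r by simp
  finally show ?thesis
    unfolding biclique_imbalance_def 1 by (simp add: algebra_simps)
qed

text \<open>
  A level function realises an order pattern of the two sides, read from level 0 upwards:
  \<open>A B A B A\<close> with the middle \<open>A\<close> of size \<open>card A mod 2\<close> if \<open>E\<close> and \<open>L\<close> lie on the same side \<open>A\<close>,
  and \<open>A B A B\<close> with halved sides if \<open>E \<subseteq> A\<close> and \<open>L \<subseteq> B\<close>. The vertices in \<open>E\<close> come before and
  those in \<open>L\<close> come after all their neighbours.
\<close>

definition optimal_levels :: "('a \<Rightarrow> nat) \<Rightarrow> 'a set \<Rightarrow> 'a set \<Rightarrow> 'a set \<Rightarrow> 'a set \<Rightarrow> bool" where
  "optimal_levels r A B E L \<longleftrightarrow>
     (\<forall>v. r v < 5) \<and> (\<forall>x\<in>A. \<forall>y\<in>B. r x \<noteq> r y) \<and>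
     biclique_imbalance r A B = biclique_optimum (card A) (card B) \<and>
     (\<forall>x\<in>A. \<forall>y\<in>B. (x \<in> E \<or> y \<in> L \<longrightarrow> r x < r y) \<and> (y \<in> E \<or> x \<in> L \<longrightarrow> r y < r x))"

lemma optimal_levels_commute: "optimal_levels r A B E L \<longleftrightarrow> optimal_levels r B A E L"
  unfolding optimal_levels_def
  by (subst biclique_imbalance_commute, subst biclique_optimum_commute, subst (2) eq_commute) blast

lemma parity_cases:
  fixes p :: nat
  obtains a where "p = 2 * a" "p div 2 = a" "p mod 2 = 0" | a where "p = 2 * a + 1" "p div 2 = a" "p mod 2 = 1"
  by (cases "even p") (auto elim!: evenE oddE)

lemma same_side_levels_optimal:
  "int (p div 2 + p div 2) * int q + int (p mod 2) * \<bar>int (q div 2) - int (q div 2 + q mod 2)\<bar>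
    + int (q div 2) * \<bar>int (p div 2) - int (p mod 2) - int (p div 2)\<bar>
    + int (q div 2 + q mod 2) * \<bar>int (p div 2) + int (p mod 2) - int (p div 2)\<bar> = biclique_optimum p q"
  unfolding biclique_optimum_def
  by (cases p rule: parity_cases; cases q rule: parity_cases; simp add: algebra_simps)

lemma opposite_sides_levels_optimal:
  "int (p div 2) * int q + int (p div 2 + p mod 2) * \<bar>int (q div 2 + q mod 2) - int (q div 2)\<bar>
    + int (q div 2 + q mod 2) * \<bar>int (p div 2) - int (p div 2 + p mod 2)\<bar>
    + int (q div 2) * \<bar>int (p div 2) + int (p div 2 + p mod 2)\<bar> = biclique_optimum p q"
  unfolding biclique_optimum_def
  by (cases p rule: parity_cases; cases q rule: parity_cases; simp add: algebra_simps)

lemma optimal_levels_same_side: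
  fixes A B E L :: "'a set"
  assumes fin: "finite A" "finite B" and disj: "A \<inter> B = {}"
    and EL: "E \<subseteq> A" "L \<subseteq> A" "E \<inter> L = {}" "card E \<le> card A div 2" "card L \<le> card A div 2"
  shows "\<exists>r. optimal_levels r A B E L"
proof -
  have finEL: "finite E" "finite L" using EL fin finite_subset by blast+
  have "card A div 2 \<le> card (A - L)"
    using EL(5) card_Diff_subset[OF finEL(2) EL(2)] by linarith
  then obtain A0 where A0: "E \<subseteq> A0" "A0 \<subseteq> A - L" "card A0 = card A div 2"
    using exists_subset_between[of E "card A div 2" "A - L"] EL fin by auto
  have finA0: "finite A0" using A0 fin(1) finite_subset by blast
  have "card A div 2 \<le> card (A - A0)"
  proof -
    have "card (A - A0) = card A - card A div 2" using card_Diff_subset[OF finA0, of A] A0(2,3) by auto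
    then show ?thesis by linarith
  qed
  moreover have "L \<subseteq> A - A0" using EL(2) A0(2) by blast
  ultimately obtain A4 where A4: "L \<subseteq> A4" "A4 \<subseteq> A - A0" "card A4 = card A div 2"
    using exists_subset_between[of L "card A div 2" "A - A0"] EL fin A0 by auto
  have finA4: "finite A4" using A4 fin(1) finite_subset by blast
  obtain B1 where B1: "B1 \<subseteq> B" "card B1 = card B div 2"
    using exists_subset_between[of "{}" "card B div 2" B] fin(2) by auto
  define A2 where "A2 = A - A0 - A4"
  define B3 where "B3 = B - B1"
  have "card (A0 \<union> A4) = 2 * (card A div 2)"
    using A0 A4 finA0 finA4 by (subst card_Un_disjoint) auto
  moreover have "card A2 = card A - card (A0 \<union> A4)"
    using A0 A4 finA0 finA4 by (subst card_Diff_subset[symmetric]) (auto simp: A2_def intro!: arg_cong[where f = card])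
  ultimately have cA2: "card A2 = card A mod 2"
    by (simp add: minus_mult_div_eq_mod)
  have cB3: "card B3 = card B div 2 + card B mod 2"
    unfolding B3_def using B1 fin finite_subset[OF B1(1)]
    by (simp add: card_Diff_subset) presburger
  define r :: "'a \<Rightarrow> nat" where
    "r v = (if v \<in> A0 then 0 else if v \<in> B1 then 1 else if v \<in> A2 then 2 else if v \<in> B3 then 3 else 4)" for v
  have sub: "A0 \<subseteq> A" "A2 \<subseteq> A" "A4 \<subseteq> A" "B1 \<subseteq> B" "B3 \<subseteq> B" "A0 \<inter> A2 = {}" "A0 \<inter> A4 = {}" "A2 \<inter> A4 = {}"
    "B1 \<inter> B3 = {}" "A = A0 \<union> A2 \<union> A4" "B = B1 \<union> B3"
    using A0 A4 B1 by (auto simp: A2_def B3_def)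
  have rA: "r v = 0" if "v \<in> A0" for v using that by (simp add: r_def)
  have rA2: "r v = 2" if "v \<in> A2" for v using that sub disj by (auto simp: r_def)
  have rA4: "r v = 4" if "v \<in> A4" for v using that sub disj by (auto simp: r_def)
  have rB1: "r v = 1" if "v \<in> B1" for v using that sub disj by (auto simp: r_def)
  have rB3: "r v = 3" if "v \<in> B3" for v using that sub disj by (auto simp: r_def)
  have "biclique_imbalance r A B = biclique_optimum (card A) (card B)"
    by (subst biclique_imbalance_levels[OF fin sub(10,6,7,8,11,9) rA rB1 rA2 rB3 rA4])
      (simp_all only: A0(3) A4(3) cA2 B1(2) cB3 same_side_levels_optimal)
  moreover have "r x \<noteq> r y \<and> (x \<in> E \<or> y \<in> L \<longrightarrow> r x < r y) \<and> (y \<in> E \<or> x \<in> L \<longrightarrow> r y < r x)"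
    if "x \<in> A" "y \<in> B" for x y
  proof -
    have "r x = 0 \<or> r x = 2 \<or> r x = 4" using that(1) sub(10) rA rA2 rA4 by blast
    moreover have "r y = 1 \<or> r y = 3" using that(2) sub(11) rB1 rB3 by blast
    moreover have "y \<notin> E" "y \<notin> L" using that EL disj by blast+
    moreover have "x \<in> E \<Longrightarrow> r x = 0" "x \<in> L \<Longrightarrow> r x = 4" using A0 A4 rA rA4 by blast+
    ultimately show ?thesis by auto
  qed
  ultimately have "optimal_levels r A B E L"
    unfolding optimal_levels_def by (auto simp: r_def)
  then show ?thesis by blast
qed

lemma optimal_levels_opposite_sides:
  fixes A B E L :: "'a set"
  assumes fin: "finite A" "finite B" and disj: "A \<inter> B = {}"
    and EL: "E \<subseteq> A" "L \<subseteq> B" "card E \<le> card A div 2" "card L \<le> card B div 2"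
  shows "\<exists>r. optimal_levels r A B E L"
proof -
  obtain A0 where A0: "E \<subseteq> A0" "A0 \<subseteq> A" "card A0 = card A div 2"
    using exists_subset_between[of E "card A div 2" A] EL fin by auto
  obtain B3 where B3: "L \<subseteq> B3" "B3 \<subseteq> B" "card B3 = card B div 2"
    using exists_subset_between[of L "card B div 2" B] EL fin by auto
  define A2 where "A2 = A - A0"
  define B1 where "B1 = B - B3"
  have cA2: "card A2 = card A div 2 + card A mod 2"
    unfolding A2_def using A0 fin finite_subset[OF A0(2)]
    by (simp add: card_Diff_subset) presburger
  have cB1: "card B1 = card B div 2 + card B mod 2"
    unfolding B1_def using B3 fin finite_subset[OF B3(2)]
    by (simp add: card_Diff_subset) presburger
  define r :: "'a \<Rightarrow> nat" where
    "r v = (if v \<in> A0 then 0 else if v \<in> B1 then 1 else if v \<in> A2 then 2 else 3)" for v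
  have sub: "A0 \<subseteq> A" "A2 \<subseteq> A" "B1 \<subseteq> B" "B3 \<subseteq> B" "A0 \<inter> A2 = {}"
    "B1 \<inter> B3 = {}" "A = A0 \<union> A2 \<union> {}" "B = B1 \<union> B3"
    using A0 B3 by (auto simp: A2_def B1_def)
  have rA: "r v = 0" if "v \<in> A0" for v using that by (simp add: r_def)
  have rA2: "r v = 2" if "v \<in> A2" for v using that sub disj by (auto simp: r_def)
  have rB1: "r v = 1" if "v \<in> B1" for v using that sub disj by (auto simp: r_def)
  have rB3: "r v = 3" if "v \<in> B3" for v using that sub disj by (auto simp: r_def)
  have "biclique_imbalance r A B = biclique_optimum (card A) (card B)"
    using opposite_sides_levels_optimal[of "card A" "card B"]
    by (subst biclique_imbalance_levels[OF fin sub(7,5) _ _ sub(8,6) rA rB1 rA2 rB3])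
      (simp_all only: A0(3) B3(3) cA2 cB1, auto)
  moreover have "r x \<noteq> r y \<and> (x \<in> E \<or> y \<in> L \<longrightarrow> r x < r y) \<and> (y \<in> E \<or> x \<in> L \<longrightarrow> r y < r x)"
    if "x \<in> A" "y \<in> B" for x y
  proof -
    have "r x = 0 \<or> r x = 2" using that(1) sub(7) rA rA2 by blast
    moreover have "r y = 1 \<or> r y = 3" using that(2) sub(8) rB1 rB3 by blast
    moreover have "y \<notin> E" "x \<notin> L" using that EL disj by blast+
    moreover have "x \<in> E \<Longrightarrow> r x = 0" "y \<in> L \<Longrightarrow> r y = 3" using A0 B3 rA rB3 by blast+
    ultimately show ?thesis by auto
  qed
  ultimately have "optimal_levels r A B E L"
    unfolding optimal_levels_def by (auto simp: r_def)
  then show ?thesis by blast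
qed

lemma optimal_levels_exist:
  fixes A B E L :: "'a set"
  assumes fin: "finite A" "finite B" and disj: "A \<inter> B = {}"
    and EL: "E \<subseteq> A \<union> B" "L \<subseteq> A \<union> B" "E \<inter> L = {}" "card E \<le> 1" "card L \<le> 1"
    and A: "A \<inter> (E \<union> L) \<noteq> {} \<Longrightarrow> card A \<ge> 2"
    and B: "B \<inter> (E \<union> L) \<noteq> {} \<Longrightarrow> card B \<ge> 2"
  shows "\<exists>r. optimal_levels r A B E L"
proof -
  have side: "S \<subseteq> A \<or> S \<subseteq> B" if "S \<subseteq> A \<union> B" "card S \<le> 1" for S
  proof -
    have "finite S" using that(1) fin finite_subset by blast
    then have "S = {} \<or> (\<exists>s. S = {s})"
      using that(2) by (metis One_nat_def card_0_eq card_1_singletonE le_Suc_eq le_zero_eq)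
    then show ?thesis using that(1) by auto
  qed
  have half: "card S \<le> card T div 2" if "S \<subseteq> T" "card S \<le> 1" "T \<inter> S \<noteq> {} \<Longrightarrow> card T \<ge> 2" for S T :: "'a set"
  proof (cases "S = {}")
    case False
    then have "card T \<ge> 2" using that by blast
    then show ?thesis using that(2) by linarith
  qed simp
  have halfE: "E \<subseteq> A \<Longrightarrow> card E \<le> card A div 2" "E \<subseteq> B \<Longrightarrow> card E \<le> card B div 2"
    and halfL: "L \<subseteq> A \<Longrightarrow> card L \<le> card A div 2" "L \<subseteq> B \<Longrightarrow> card L \<le> card B div 2"
    using A B EL(4,5) by (auto intro!: half)
  have disj': "B \<inter> A = {}" using disj by blast
  consider "E \<subseteq> A" "L \<subseteq> A" | "E \<subseteq> B" "L \<subseteq> B" | "E \<subseteq> A" "L \<subseteq> B" | "E \<subseteq> B" "L \<subseteq> A"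
    using side[OF EL(1,4)] side[OF EL(2,5)] by blast
  then show ?thesis
  proof cases
    case 1
    then show ?thesis using optimal_levels_same_side[OF fin disj] EL halfE halfL by blast
  next
    case 2
    then show ?thesis
      using optimal_levels_same_side[OF fin(2,1) disj'] EL halfE halfL optimal_levels_commute by metis
  next
    case 3
    then show ?thesis using optimal_levels_opposite_sides[OF fin disj] halfE halfL by blast
  next
    case 4
    then show ?thesis
      using optimal_levels_opposite_sides[OF fin(2,1) disj'] halfE halfL optimal_levels_commute by metis
  qed
qed

text \<open>
  Only non-adjacent vertices share a level, so ties do not influence imbalances and can be broken
  arbitrarily.
\<close>

lemma ordering_refining_levels:
  fixes f :: "'a \<Rightarrow> nat"
  assumes "finite (verts G)"
  shows "\<exists>\<sigma>. ordering G \<sigma> \<and> (\<forall>u\<in>verts G. \<forall>v\<in>verts G. f u < f v \<longrightarrow> \<sigma> u < \<sigma> v)"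
proof -
  let ?V = "verts G" and ?N = "card (verts G)"
  obtain e where e: "bij_betw e ?V {0..<?N}"
    using ex_bij_betw_finite_nat[OF assms] by blast
  have eN: "e v < ?N" if "v \<in> ?V" for v using bij_betwE[OF e] that by auto
  define h where "h v = f v * ?N + e v" for v
  have h_less: "h u < h v" if "u \<in> ?V" "v \<in> ?V" "f u < f v" for u v
  proof -
    have "h u < (f u + 1) * ?N" using eN[OF that(1)] by (simp add: h_def)
    also have "\<dots> \<le> f v * ?N" using that(3) by (intro mult_right_mono) auto
    finally show ?thesis by (simp add: h_def)
  qed
  have inj: "inj_on h ?V"
  proof (rule inj_onI)
    fix u v assume uv: "u \<in> ?V" "v \<in> ?V" "h u = h v"
    then have "f u = f v" using h_less[of u v] h_less[of v u] by (metis less_irrefl nat_neq_iff)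
    then have "e u = e v" using uv(3) by (simp add: h_def)
    then show "u = v" using e uv by (auto simp: bij_betw_def dest: inj_onD)
  qed
  let ?\<sigma> = "\<lambda>v. Suc (card {u \<in> ?V. h u < h v})"
  have "bij_betw Suc {..<?N} {1..?N}"
    by (simp add: bij_betw_def image_Suc_lessThan)
  from bij_betw_trans[OF bij_betw_rank[OF assms inj] this]
  have "ordering G ?\<sigma>" by (simp add: ordering_def comp_def)
  moreover have "?\<sigma> u < ?\<sigma> v" if "u \<in> ?V" "v \<in> ?V" "f u < f v" for u v
  proof -
    have "{w \<in> ?V. h w < h u} \<subset> {w \<in> ?V. h w < h v}" using h_less[OF that] that by auto
    then have "card {w \<in> ?V. h w < h u} < card {w \<in> ?V. h w < h v}"
      by (intro psubset_card_mono) (simp add: assms)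
    then show ?thesis by simp
  qed
  ultimately show ?thesis by blast
qed

section \<open>Chained complete bipartite graphs\<close>

context graph
begin

lemma finite_neighbours: "finite (neighbours G v)"
  by (rule finite_subset[OF _ finite_verts]) (auto simp: neighbours_def)

lemma dominates_sym: "u \<rightarrow> v \<Longrightarrow> v \<rightarrow> u"
  using sym_arcs by (rule arcs_ends_symmetric)

lemma dominates_induce_iff: "u \<rightarrow>\<^bsub>G \<restriction> S\<^esub> v \<longleftrightarrow> u \<in> S \<and> v \<in> S \<and> u \<rightarrow> v"
  by (auto simp: arcs_ends_conv)

lemma graph_induce_subgraph:
  assumes "S \<subseteq> verts G"
  shows "graph (G \<restriction> S)"
proof -
  have ind: "induced_subgraph (G \<restriction> S) G" using assms by (rule induced_induce)
  interpret S: digraph "G \<restriction> S" using ind by (rule digraphI_induced)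
  interpret S: sym_digraph "G \<restriction> S" using ind by (rule induced_graph_imp_graph)
  show ?thesis by unfold_locales
qed

lemma complete_bipartite_induce_iff:
  assumes "S \<subseteq> verts G"
  shows "complete_bipartite (G \<restriction> S) \<longleftrightarrow>
    (\<exists>U W. S = U \<union> W \<and> U \<inter> W = {} \<and>
      (\<forall>u\<in>S. \<forall>v\<in>S. u \<rightarrow> v \<longleftrightarrow> u \<in> U \<and> v \<in> W \<or> u \<in> W \<and> v \<in> U))"
proof -
  have eq: "arcs_ends (G \<restriction> S) = U \<times> W \<union> W \<times> U \<longleftrightarrow>
      (\<forall>u\<in>S. \<forall>v\<in>S. u \<rightarrow> v \<longleftrightarrow> u \<in> U \<and> v \<in> W \<or> u \<in> W \<and> v \<in> U)" (is "?l \<longleftrightarrow> ?r")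
    if "S = U \<union> W" for U W
  proof -
    have "?l \<longleftrightarrow> (\<forall>u v. u \<rightarrow>\<^bsub>G \<restriction> S\<^esub> v \<longleftrightarrow> u \<in> U \<and> v \<in> W \<or> u \<in> W \<and> v \<in> U)"
      by (auto simp: set_eq_iff)
    also have "\<dots> \<longleftrightarrow> ?r" unfolding dominates_induce_iff using that by blast
    finally show ?thesis .
  qed
  have "complete_bipartite (G \<restriction> S) \<longleftrightarrow>
      (\<exists>U W. S = U \<union> W \<and> U \<inter> W = {} \<and> arcs_ends (G \<restriction> S) = U \<times> W \<union> W \<times> U)"
    unfolding complete_bipartite_def complete_bipartite_digraph_def induce_subgraph_verts
    using graph_induce_subgraph[OF assms] by blast
  also have "\<dots> \<longleftrightarrow> (\<exists>U W. S = U \<union> W \<and> U \<inter> W = {} \<and>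
      (\<forall>u\<in>S. \<forall>v\<in>S. u \<rightarrow> v \<longleftrightarrow> u \<in> U \<and> v \<in> W \<or> u \<in> W \<and> v \<in> U))"
    by (intro ex_cong1 conj_cong refl eq)
  finally show ?thesis .
qed

lemma complete_bipartite_pair:
  assumes "u \<in> verts G" "v \<in> verts G"
  shows "complete_bipartite (G \<restriction> {u, v})"
proof (cases "u \<rightarrow> v")
  case True
  then have "u \<noteq> v" "v \<rightarrow> u" "\<not> u \<rightarrow> u" "\<not> v \<rightarrow> v" using adj_not_same dominates_sym by blast+
  then show ?thesis
    using assms True
    by (subst complete_bipartite_induce_iff) (simp, intro exI[of _ "{u}"] exI[of _ "{v}"], auto)
next
  case False
  then have "\<not> v \<rightarrow> u" "\<not> u \<rightarrow> u" "\<not> v \<rightarrow> v" using adj_not_same dominates_sym by blast+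
  then show ?thesis
    using assms False
    by (subst complete_bipartite_induce_iff) (simp, intro exI[of _ "{u, v}"] exI[of _ "{}"], auto)
qed

lemma vertex_imbalance_eq: "vertex_imbalance v \<sigma> G = \<bar>signed_imbalance \<sigma> (neighbours G v) v\<bar>"
  by (simp add: vertex_imbalance_def signed_imbalance_eq_card_diff finite_neighbours)

lemma connected_closed_eq_verts:
  assumes "Digraph_Component.connected G" and "S \<subseteq> verts G" "S \<noteq> {}"
    and closed: "\<And>u v. u \<in> S \<Longrightarrow> u \<rightarrow> v \<Longrightarrow> v \<in> S"
  shows "S = verts G"
proof -
  obtain u where u: "u \<in> S" using assms(3) by blast
  have "v \<in> S" if "v \<in> verts G" for v
  proof -
    have "u \<rightarrow>\<^sup>* v"
      using symmetric_connected_imp_strongly_connected[OF sym_arcs assms(1)] u that assms(2)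
      by (auto simp: strongly_connected_def)
    then show ?thesis
      by (induct rule: reachable_induct) (use u closed in blast)+
  qed
  then show ?thesis using assms(2) by blast
qed

end

locale chained_bipartite_graph = graph G for G :: "('a, 'b) pre_digraph" +
  fixes X Y :: "'a set" and \<C> :: "'a set set" and n :: nat and C :: "nat \<Rightarrow> 'a set"
  assumes connected: "Digraph_Component.connected G"
    and chained: "chained_complete_bipartite G X Y \<C> n C"
begin

lemma sides:
  shows sides_Un: "X \<union> Y = verts G" and sides_disjoint: "X \<inter> Y = {}"
    and edge_sides: "u \<rightarrow>\<^bsub>G\<^esub> v \<Longrightarrow> u \<in> X \<and> v \<in> Y \<or> u \<in> Y \<and> v \<in> X"
  using chained by (auto simp: chained_complete_bipartite_def bipartition_def)

lemma swap_sides: "chained_bipartite_graph G Y X \<C> n C"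
proof -
  have "bipartition G Y X" using chained
    by (auto simp: chained_complete_bipartite_def bipartition_def)
  then have "chained_complete_bipartite G Y X \<C> n C"
    using chained by (simp add: chained_complete_bipartite_def)
  then show ?thesis using connected by unfold_locales
qed

lemma family: "\<C> = C ` {1..n}" "inj_on C {1..n}"
  using chained by (auto simp: chained_complete_bipartite_def chain_labelling_def bij_betw_def)

lemma block_subset: "i \<in> {1..n} \<Longrightarrow> C i \<subseteq> verts G"
  using chained family by (auto simp: chained_complete_bipartite_def mcb_component_family_def)

lemma finite_block: "i \<in> {1..n} \<Longrightarrow> finite (C i)"
  using block_subset finite_verts finite_subset by metis

lemma edge_in_block:
  assumes "u \<rightarrow>\<^bsub>G\<^esub> v"
  obtains i where "i \<in> {1..n}" "u \<in> C i" "v \<in> C i"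
proof -
  have "\<exists>D\<in>\<C>. u \<in> D \<and> v \<in> D"
    using chained assms by (simp add: chained_complete_bipartite_def mcb_component_family_def)
  then show thesis using that family(1) by auto
qed

lemma block_complete_bipartite: "i \<in> {1..n} \<Longrightarrow> complete_bipartite (G \<restriction> C i)"
  using chained family by (auto simp: chained_complete_bipartite_def mcb_component_family_def)

lemma block_maximal:
  "i \<in> {1..n} \<Longrightarrow> v \<in> verts G - C i \<Longrightarrow> \<not> complete_bipartite (G \<restriction> (C i \<union> {v}))"
  using chained family(1) by (simp add: chained_complete_bipartite_def mcb_component_family_def)

lemma block_inter_Suc:
  assumes "i \<in> {1..<n}"
  shows "C i \<inter> C (i + 1) = {link_vertex C i}"
proof -
  have "card (C i \<inter> C (i + 1)) = 1"
    using chained assms unfolding chained_complete_bipartite_def chain_labelling_def by blast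
  then obtain v where "C i \<inter> C (i + 1) = {v}" by (rule card_1_singletonE)
  then show ?thesis by (simp add: link_vertex_def)
qed

lemma block_inter_far:
  assumes "i \<in> {1..n}" "j \<in> {1..n}" "i + 1 < j"
  shows "C i \<inter> C j = {}"
proof -
  have "\<bar>int i - int j\<bar> > 1" using assms(3) by linarith
  then show ?thesis
    using chained assms(1,2) unfolding chained_complete_bipartite_def chain_labelling_def by blast
qed

lemma block_interE:
  assumes "i \<in> {1..n}" "j \<in> {1..n}" "i < j" "v \<in> C i" "v \<in> C j"
  shows "j = i + 1 \<and> i \<in> {1..<n} \<and> v = link_vertex C i"
proof -
  have "\<not> i + 1 < j" using block_inter_far[OF assms(1,2)] assms(4,5) by blast
  then have j: "j = i + 1" using assms(3) by simp
  then have "i \<in> {1..<n}" using assms(1,2) by auto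
  then show ?thesis using block_inter_Suc[of i] assms(4,5) j by blast
qed

lemma common_vertex_unique:
  assumes "i \<in> {1..n}" "j \<in> {1..n}" "i \<noteq> j" "u \<in> C i" "u \<in> C j" "v \<in> C i" "v \<in> C j"
  shows "u = v"
  using assms block_interE[of i j u] block_interE[of i j v] block_interE[of j i u] block_interE[of j i v]
  by (cases i j rule: linorder_cases) auto

lemma link_in_blocks:
  assumes "i \<in> {1..<n}"
  shows "link_vertex C i \<in> C i" "link_vertex C i \<in> C (i + 1)"
  using block_inter_Suc[OF assms] by blast+

lemma inj_on_link: "inj_on (link_vertex C) {1..<n}"
proof (rule inj_onI)
  have "link_vertex C i \<noteq> link_vertex C j" if "i \<in> {1..<n}" "j \<in> {1..<n}" "i < j" for i j
    using block_inter_far[of i "j + 1"] link_in_blocks[OF that(1)] link_in_blocks[OF that(2)] that by auto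
  then show "i = j"
    if "i \<in> {1..<n}" "j \<in> {1..<n}" "link_vertex C i = link_vertex C j" for i j
    using that by (metis nat_neq_iff)
qed

text \<open>
  Without the edges of \<open>C i\<close>, the blocks before and the blocks after \<open>C i\<close> would be closed under
  adjacency, so one of these two unions would be the whole vertex set.
\<close>

lemma edgeless_block_card_le:
  assumes i: "i \<in> {1..n}" and edgeless: "\<And>u v. u \<in> C i \<Longrightarrow> v \<in> C i \<Longrightarrow> \<not> u \<rightarrow>\<^bsub>G\<^esub> v"
  shows "card (C i) \<le> 1"
proof (rule ccontr)
  assume "\<not> card (C i) \<le> 1"
  then obtain u w where uw: "u \<in> C i" "w \<in> C i" "u \<noteq> w"
    using finite_block[OF i] by (auto simp: card_le_Suc0_iff_eq)
  define P where "P = (\<Union>j\<in>{1..<i}. C j)"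
  define Q where "Q = (\<Union>j\<in>{i<..n}. C j)"
  have PQ: "P \<inter> Q = {}"
  proof -
    have "C j \<inter> C k = {}" if "j \<in> {1..<i}" "k \<in> {i<..n}" for j k
      using block_inter_far[of j k] that i by auto
    then show ?thesis unfolding P_def Q_def by blast
  qed
  have edge: "a \<in> P \<and> b \<in> P \<or> a \<in> Q \<and> b \<in> Q" if ab: "a \<rightarrow>\<^bsub>G\<^esub> b" for a b
  proof -
    obtain j where j: "j \<in> {1..n}" "a \<in> C j" "b \<in> C j" using edge_in_block[OF ab] .
    then have "j \<noteq> i" using edgeless ab by blast
    then have "j \<in> {1..<i} \<or> j \<in> {i<..n}" using j(1) by auto
    then show ?thesis using j unfolding P_def Q_def by blast
  qed
  have sub: "P \<subseteq> verts G" "Q \<subseteq> verts G"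
    unfolding P_def Q_def by (intro UN_least block_subset; use i in auto)+
  have nP: "P \<noteq> verts G"
  proof
    assume "P = verts G"
    then have "u \<in> P" "w \<in> P" using uw block_subset[OF i] by auto
    then obtain j k where jk: "j \<in> {1..<i}" "k \<in> {1..<i}" "u \<in> C j" "w \<in> C k" unfolding P_def by auto
    then have "j + 1 = i" "k + 1 = i"
      using block_interE[of j i u] block_interE[of k i w] i uw by auto
    then show False using common_vertex_unique[of j i u w] jk i uw by auto
  qed
  have nQ: "Q \<noteq> verts G"
  proof
    assume "Q = verts G"
    then have "u \<in> Q" "w \<in> Q" using uw block_subset[OF i] by auto
    then obtain j k where jk: "j \<in> {i<..n}" "k \<in> {i<..n}" "u \<in> C j" "w \<in> C k" unfolding Q_def by auto
    then have "j = i + 1" "k = i + 1"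
      using block_interE[of i j u] block_interE[of i k w] i uw by auto
    then show False using common_vertex_unique[of j i u w] jk i uw by auto
  qed
  have "P = {}"
    using connected_closed_eq_verts[OF connected sub(1)] nP edge PQ by blast
  moreover have "Q = {}"
    using connected_closed_eq_verts[OF connected sub(2)] nQ edge PQ by blast
  ultimately have "\<not> a \<rightarrow>\<^bsub>G\<^esub> b" for a b using edge by blast
  then have "{u} = verts G"
    using connected_closed_eq_verts[OF connected, of "{u}"] uw block_subset[OF i] by blast
  then show False using uw block_subset[OF i] by auto
qed

lemma block_complete:
  assumes i: "i \<in> {1..n}" and x: "x \<in> X \<inter> C i" and y: "y \<in> Y \<inter> C i"
  shows "x \<rightarrow>\<^bsub>G\<^esub> y"
proof -
  obtain U W where UW: "C i = U \<union> W" "U \<inter> W = {}"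
    and adj: "\<And>u v. u \<in> C i \<Longrightarrow> v \<in> C i \<Longrightarrow> u \<rightarrow>\<^bsub>G\<^esub> v \<longleftrightarrow> u \<in> U \<and> v \<in> W \<or> u \<in> W \<and> v \<in> U"
    using block_complete_bipartite[OF i] complete_bipartite_induce_iff[OF block_subset[OF i]] by metis
  have "x \<noteq> y" using x y sides_disjoint by blast
  then have "\<not> card (C i) \<le> 1"
    using x y finite_block[OF i] by (auto simp: card_le_Suc0_iff_eq)
  then obtain a b where "a \<in> C i" "b \<in> C i" "a \<rightarrow>\<^bsub>G\<^esub> b" using edgeless_block_card_le[OF i] by blast
  then obtain u w where uw: "u \<in> U" "w \<in> W" using adj by blast
  have "\<not> (x \<in> U \<and> y \<in> U)"
    using adj[of x w] adj[of y w] uw UW edge_sides[of x w] edge_sides[of y w] x y sides_disjoint by blast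
  moreover have "\<not> (x \<in> W \<and> y \<in> W)"
    using adj[of x u] adj[of y u] uw UW edge_sides[of x u] edge_sides[of y u] x y sides_disjoint by blast
  ultimately show ?thesis using adj[of x y] x y UW by blast
qed

lemma neighbours_in_block:
  assumes "i \<in> {1..n}" "x \<in> X \<inter> C i"
  shows "neighbours G x \<inter> C i = Y \<inter> C i"
  using assms block_complete edge_sides sides_disjoint unfolding neighbours_def by blast

lemma neighbouring_block:
  assumes "i \<in> {1..n}" "n \<ge> 2"
  obtains j s where "j \<in> {1..n}" "j \<noteq> i" "s \<in> C i" "s \<in> C j"
proof (cases "i < n")
  case True
  then show ?thesis using link_in_blocks[of i] assms that[of "i + 1"] by auto
next
  case False
  then have "i - 1 \<in> {1..<n}" "i - 1 + 1 = i" using assms by auto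
  then show ?thesis using link_in_blocks[of "i - 1"] that[of "i - 1"] by auto
qed

lemma sides_of_block_nonempty:
  assumes i: "i \<in> {1..n}" and n: "n \<ge> 2"
  shows "X \<inter> C i \<noteq> {}" "Y \<inter> C i \<noteq> {}"
proof -
  have "\<not> card (C i) \<le> 1"
  proof
    assume le: "card (C i) \<le> 1"
    obtain j s where j: "j \<in> {1..n}" "j \<noteq> i" and s: "s \<in> C i" "s \<in> C j"
      using neighbouring_block[OF i n] .
    have Ci: "C i = {s}"
      using le s finite_block[OF i] by (auto simp: card_le_Suc0_iff_eq)
    have "C j \<noteq> C i" using inj_onD[OF family(2), of j i] i j by blast
    then obtain w where w: "w \<in> C j" "w \<noteq> s" using s unfolding Ci by auto
    have "complete_bipartite (G \<restriction> {s, w})"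
      using w s block_subset i j by (intro complete_bipartite_pair) blast+
    moreover have "C i \<union> {w} = {s, w}" using Ci by blast
    ultimately show False
      using block_maximal[OF i, of w] w Ci block_subset[OF j(1)] by auto
  qed
  then obtain a b where "a \<in> C i" "b \<in> C i" "a \<rightarrow>\<^bsub>G\<^esub> b" using edgeless_block_card_le[OF i] by blast
  then show "X \<inter> C i \<noteq> {}" "Y \<inter> C i \<noteq> {}" using edge_sides by blast+
qed

lemma shared_vertex_side_ge_2:
  assumes i: "i \<in> {1..n}" and j: "j \<in> {1..n}" "j \<noteq> i" and s: "s \<in> C i" "s \<in> C j" "s \<in> X"
  shows "card (X \<inter> C i) \<ge> 2"
proof (rule ccontr)
  assume "\<not> ?thesis"
  then have "card (X \<inter> C i) \<le> Suc 0" by simp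
  then have Xi: "X \<inter> C i = {s}" using s finite_block[OF i] by (auto simp: card_le_Suc0_iff_eq)
  have "n \<ge> 2" using i j by auto
  then obtain y where y: "y \<in> Y" "y \<in> C j" using sides_of_block_nonempty[OF j(1)] by blast
  have "s \<noteq> y" using y s sides_disjoint by blast
  then have yi: "y \<notin> C i" using common_vertex_unique[of i j s y] i j s y by blast
  have sy: "s \<rightarrow>\<^bsub>G\<^esub> y" using block_complete[OF j(1), of s y] y s by blast
  let ?S = "C i \<union> {y}" and ?W = "(Y \<inter> C i) \<union> {y}"
  have sub: "?S \<subseteq> verts G" using block_subset i j y by blast
  have S: "?S = {s} \<union> ?W" using Xi sides_Un block_subset[OF i] by blast
  have "{s} \<inter> ?W = {}" using y s sides_disjoint by blast
  moreover have "u \<rightarrow>\<^bsub>G\<^esub> v \<longleftrightarrow> u \<in> {s} \<and> v \<in> ?W \<or> u \<in> ?W \<and> v \<in> {s}" if uv: "u \<in> ?S" "v \<in> ?S" for u v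
  proof -
    have W: "?W \<subseteq> Y" using y by blast
    have "s \<rightarrow>\<^bsub>G\<^esub> w" if "w \<in> ?W" for w using block_complete[OF i, of s w] that sy s by blast
    moreover have "u \<in> {s} \<or> u \<in> ?W" "v \<in> {s} \<or> v \<in> ?W" using uv unfolding S by blast+
    ultimately show ?thesis
      using edge_sides[of u v] subsetD[OF W, of u] subsetD[OF W, of v] s(3) sides_disjoint dominates_sym
      by (metis disjoint_iff singletonD singletonI)
  qed
  ultimately have "complete_bipartite (G \<restriction> ?S)"
    unfolding complete_bipartite_induce_iff[OF sub]
    using S by (intro exI[of _ "{s}"] exI[of _ ?W] conjI ballI)
  then show False using block_maximal[OF i, of y] y yi block_subset[OF j(1)] by blast
qed

lemma blocks_of_link:
  assumes "i \<in> {1..<n}"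
  shows "{j \<in> {1..n}. link_vertex C i \<in> C j} = {i, i + 1}"
proof -
  have "j = i \<or> j = i + 1" if j: "j \<in> {1..n}" "link_vertex C i \<in> C j" for j
  proof (rule ccontr)
    assume "\<not> ?thesis"
    then consider "j < i" | "i + 1 < j" by linarith
    then show False
    proof cases
      case 1
      then show False using block_interE[of j "i + 1"] j link_in_blocks[OF assms] assms by auto
    next
      case 2
      then show False using block_interE[of i j] j link_in_blocks[OF assms] assms by auto
    qed
  qed
  moreover have "i \<in> {1..n}" "i + 1 \<in> {1..n}" using assms by auto
  ultimately show ?thesis using link_in_blocks[OF assms] by blast
qed

lemma block_of_nonlink_unique:
  assumes "v \<notin> link_vertex C ` {1..<n}" "i \<in> {1..n}" "j \<in> {1..n}" "v \<in> C i" "v \<in> C j"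
  shows "i = j"
  using assms block_interE[of i j v] block_interE[of j i v] by (cases i j rule: linorder_cases) auto

lemma block_sides: "i \<in> {1..n} \<Longrightarrow> (X \<inter> C i) \<union> (Y \<inter> C i) = C i"
  using sides_Un block_subset by blast

lemma neighbours_in_block_Y:
  assumes "i \<in> {1..n}" "y \<in> Y \<inter> C i"
  shows "neighbours G y \<inter> C i = X \<inter> C i"
proof -
  interpret swap: chained_bipartite_graph G Y X \<C> n C by (rule swap_sides)
  show ?thesis using assms by (rule swap.neighbours_in_block)
qed

lemma signed_imbalance_blocks:
  "signed_imbalance \<sigma> (neighbours G v) v =
     (\<Sum>i\<in>{i \<in> {1..n}. v \<in> C i}. signed_imbalance \<sigma> (neighbours G v \<inter> C i) v)"
proof -
  let ?I = "{i \<in> {1..n}. v \<in> C i}"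
  have "neighbours G v = (\<Union>i\<in>?I. neighbours G v \<inter> C i)"
    unfolding neighbours_def using edge_in_block by blast
  then have "signed_imbalance \<sigma> (neighbours G v) v = signed_imbalance \<sigma> (\<Union>i\<in>?I. neighbours G v \<inter> C i) v"
    by simp
  also have "\<dots> = (\<Sum>i\<in>?I. signed_imbalance \<sigma> (neighbours G v \<inter> C i) v)"
    unfolding signed_imbalance_def
  proof (rule sum.UNION_disjoint)
    show "\<forall>i\<in>?I. \<forall>j\<in>?I. i \<noteq> j \<longrightarrow> neighbours G v \<inter> C i \<inter> (neighbours G v \<inter> C j) = {}"
    proof (intro ballI impI)
      fix i j assume ij: "i \<in> ?I" "j \<in> ?I" "i \<noteq> j"
      have "u \<notin> neighbours G v" if "u \<in> C i" "u \<in> C j" for u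
        using common_vertex_unique[of i j u v] that ij adj_not_same by (auto simp: neighbours_def)
      then show "neighbours G v \<inter> C i \<inter> (neighbours G v \<inter> C j) = {}" by blast
    qed
  qed (use finite_neighbours in auto)
  finally show ?thesis .
qed

lemma sum_abs_signed_imbalance_block:
  assumes i: "i \<in> {1..n}"
  shows "(\<Sum>v\<in>C i. \<bar>signed_imbalance \<sigma> (neighbours G v \<inter> C i) v\<bar>) =
    biclique_imbalance \<sigma> (X \<inter> C i) (Y \<inter> C i)"
proof -
  let ?d = "\<lambda>v. \<bar>signed_imbalance \<sigma> (neighbours G v \<inter> C i) v\<bar>"
  have "(\<Sum>v\<in>C i. ?d v) = (\<Sum>v\<in>(X \<inter> C i) \<union> (Y \<inter> C i). ?d v)"
    by (simp only: block_sides[OF i])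
  also have "\<dots> = (\<Sum>v\<in>X \<inter> C i. ?d v) + (\<Sum>v\<in>Y \<inter> C i. ?d v)"
    using finite_block[OF i] sides_disjoint by (intro sum.union_disjoint) auto
  also have "\<dots> = biclique_imbalance \<sigma> (X \<inter> C i) (Y \<inter> C i)"
    unfolding biclique_imbalance_def
    using neighbours_in_block[OF i] neighbours_in_block_Y[OF i] by simp
  finally show ?thesis .
qed

lemma ordering_imbalance_decomposition:
  fixes \<sigma> :: "'a \<Rightarrow> nat"
  defines "d \<equiv> \<lambda>i j. signed_imbalance \<sigma> (neighbours G (link_vertex C i) \<inter> C j) (link_vertex C i)"
  shows "ordering_imbalance \<sigma> G = (\<Sum>i=1..n. biclique_imbalance \<sigma> (X \<inter> C i) (Y \<inter> C i))
    + (\<Sum>i=1..<n. \<bar>d i i + d i (i + 1)\<bar> - \<bar>d i i\<bar> - \<bar>d i (i + 1)\<bar>)"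
proof -
  let ?I = "\<lambda>v. {i \<in> {1..n}. v \<in> C i}"
  let ?D = "\<lambda>i v. signed_imbalance \<sigma> (neighbours G v \<inter> C i) v"
  define corr where "corr v = \<bar>\<Sum>i\<in>?I v. ?D i v\<bar> - (\<Sum>i\<in>?I v. \<bar>?D i v\<bar>)" for v
  have "ordering_imbalance \<sigma> G = (\<Sum>v\<in>verts G. (\<Sum>i\<in>?I v. \<bar>?D i v\<bar>) + corr v)"
    unfolding ordering_imbalance_def
    by (rule sum.cong) (simp_all add: vertex_imbalance_eq signed_imbalance_blocks corr_def)
  also have "\<dots> = (\<Sum>v\<in>verts G. \<Sum>i\<in>?I v. \<bar>?D i v\<bar>) + (\<Sum>v\<in>verts G. corr v)"
    by (rule sum.distrib)
  also have "(\<Sum>v\<in>verts G. \<Sum>i\<in>?I v. \<bar>?D i v\<bar>) = (\<Sum>i=1..n. \<Sum>v\<in>{v \<in> verts G. v \<in> C i}. \<bar>?D i v\<bar>)"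
    by (rule sum.swap_restrict) auto
  also have "\<dots> = (\<Sum>i=1..n. biclique_imbalance \<sigma> (X \<inter> C i) (Y \<inter> C i))"
  proof (rule sum.cong[OF refl])
    fix i assume i: "i \<in> {1..n}"
    then have "{v \<in> verts G. v \<in> C i} = C i" using block_subset by blast
    then show "(\<Sum>v\<in>{v \<in> verts G. v \<in> C i}. \<bar>?D i v\<bar>) = biclique_imbalance \<sigma> (X \<inter> C i) (Y \<inter> C i)"
      by (simp only: sum_abs_signed_imbalance_block[OF i])
  qed
  also have "(\<Sum>v\<in>verts G. corr v) = (\<Sum>v\<in>link_vertex C ` {1..<n}. corr v)"
  proof (rule sum.mono_neutral_right)
    show "link_vertex C ` {1..<n} \<subseteq> verts G"
    proof
      fix v assume "v \<in> link_vertex C ` {1..<n}"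
      then obtain i where i: "i \<in> {1..<n}" "v = link_vertex C i" by blast
      then show "v \<in> verts G" using link_in_blocks(1)[OF i(1)] block_subset[of i] by auto
    qed
    show "\<forall>v\<in>verts G - link_vertex C ` {1..<n}. corr v = 0"
    proof
      fix v assume "v \<in> verts G - link_vertex C ` {1..<n}"
      then have "i = j" if "i \<in> ?I v" "j \<in> ?I v" for i j
        using block_of_nonlink_unique[of v i j] that by blast
      then have "?I v = {} \<or> (\<exists>i. ?I v = {i})" by blast
      then show "corr v = 0" by (elim disjE exE) (simp_all only: corr_def sum.empty, simp_all)
    qed
  qed simp
  also have "\<dots> = (\<Sum>i=1..<n. corr (link_vertex C i))"
    by (simp only: sum.reindex[OF inj_on_link] comp_def)
  also have "\<dots> = (\<Sum>i=1..<n. \<bar>d i i + d i (i + 1)\<bar> - \<bar>d i i\<bar> - \<bar>d i (i + 1)\<bar>)"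
  proof (rule sum.cong[OF refl])
    fix i assume "i \<in> {1..<n}"
    from blocks_of_link[OF this]
    show "corr (link_vertex C i) = \<bar>d i i + d i (i + 1)\<bar> - \<bar>d i i\<bar> - \<bar>d i (i + 1)\<bar>"
      unfolding corr_def d_def by (simp only:) simp
  qed
  finally show ?thesis .
qed

definition chain_optimum :: int where
  "chain_optimum =
     (\<Sum>i=1..n. biclique_optimum (card (X \<inter> C i)) (card (Y \<inter> C i))) +
     (\<Sum>i=1..<n. \<bar>int (degree_into G (link_vertex C i) (C i)) - int (degree_into G (link_vertex C i) (C (i + 1)))\<bar>
       - int (degree_into G (link_vertex C i) (C i)) - int (degree_into G (link_vertex C i) (C (i + 1))))"

lemma ordering_imbalance_ge:
  assumes "ordering G \<sigma>"
  shows "chain_optimum \<le> ordering_imbalance \<sigma> G"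
  unfolding chain_optimum_def ordering_imbalance_decomposition
proof (intro add_mono sum_mono)
  fix i assume i: "i \<in> {1..n}"
  have "inj_on \<sigma> (verts G)" using assms by (simp add: ordering_def bij_betw_def)
  then have "inj_on \<sigma> ((X \<inter> C i) \<union> (Y \<inter> C i))"
    using inj_on_subset block_subset[OF i] by (metis block_sides[OF i])
  then show "biclique_optimum (card (X \<inter> C i)) (card (Y \<inter> C i)) \<le> biclique_imbalance \<sigma> (X \<inter> C i) (Y \<inter> C i)"
    using finite_block[OF i] sides_disjoint by (intro biclique_imbalance_ge) auto
next
  fix i
  let ?s = "link_vertex C i"
  have "\<bar>signed_imbalance \<sigma> (neighbours G ?s \<inter> C j) ?s\<bar> \<le> int (degree_into G ?s (C j))" for j
    unfolding degree_into_def by (rule abs_signed_imbalance_le)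
  from this[of i] this[of "i + 1"]
  show "\<bar>int (degree_into G ?s (C i)) - int (degree_into G ?s (C (i + 1)))\<bar>
      - int (degree_into G ?s (C i)) - int (degree_into G ?s (C (i + 1)))
    \<le> \<bar>signed_imbalance \<sigma> (neighbours G ?s \<inter> C i) ?s + signed_imbalance \<sigma> (neighbours G ?s \<inter> C (i + 1)) ?s\<bar>
      - \<bar>signed_imbalance \<sigma> (neighbours G ?s \<inter> C i) ?s\<bar>
      - \<bar>signed_imbalance \<sigma> (neighbours G ?s \<inter> C (i + 1)) ?s\<bar>"
    by linarith
qed

definition entry :: "nat \<Rightarrow> 'a set" where
  "entry i = (if i = 1 then {} else {link_vertex C (i - 1)})"

definition exit :: "nat \<Rightarrow> 'a set" where
  "exit i = (if i = n then {} else {link_vertex C i})"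

lemma entry_exit_shared:
  assumes i: "i \<in> {1..n}" and s: "s \<in> entry i \<union> exit i"
  obtains j where "j \<in> {1..n}" "j \<noteq> i" "s \<in> C i" "s \<in> C j"
proof (cases "s \<in> entry i")
  case True
  then have "i \<noteq> 1" "s = link_vertex C (i - 1)" by (auto simp: entry_def split: if_splits)
  moreover from this have "i - 1 \<in> {1..<n}" "i - 1 + 1 = i" using i by auto
  ultimately show ?thesis using link_in_blocks[of "i - 1"] that[of "i - 1"] by auto
next
  case False
  then have "i \<noteq> n" "s = link_vertex C i" using s by (auto simp: exit_def split: if_splits)
  moreover from this have "i \<in> {1..<n}" using i by auto
  ultimately show ?thesis using link_in_blocks[of i] that[of "i + 1"] by auto
qed

lemma optimal_block_levels:
  assumes i: "i \<in> {1..n}"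
  shows "\<exists>r. optimal_levels r (X \<inter> C i) (Y \<inter> C i) (entry i) (exit i)"
proof (rule optimal_levels_exist)
  interpret swap: chained_bipartite_graph G Y X \<C> n C by (rule swap_sides)
  show "finite (X \<inter> C i)" "finite (Y \<inter> C i)" using finite_block[OF i] by auto
  show "X \<inter> C i \<inter> (Y \<inter> C i) = {}" using sides_disjoint by blast
  have "entry i \<union> exit i \<subseteq> C i" using entry_exit_shared[OF i] by blast
  then show "entry i \<subseteq> (X \<inter> C i) \<union> (Y \<inter> C i)" "exit i \<subseteq> (X \<inter> C i) \<union> (Y \<inter> C i)"
    unfolding block_sides[OF i] by auto
  show "entry i \<inter> exit i = {}"
  proof (cases "i = 1 \<or> i = n")
    case False
    then have "i - 1 \<in> {1..<n}" "i \<in> {1..<n}" "i - 1 \<noteq> i" using i by auto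
    then show ?thesis using inj_onD[OF inj_on_link, of "i - 1" i] by (auto simp: entry_def exit_def)
  qed (auto simp: entry_def exit_def)
  show "card (entry i) \<le> 1" "card (exit i) \<le> 1" by (auto simp: entry_def exit_def)
  show "card (X \<inter> C i) \<ge> 2" if "X \<inter> C i \<inter> (entry i \<union> exit i) \<noteq> {}"
    using that entry_exit_shared[OF i] shared_vertex_side_ge_2[OF i] by blast
  show "card (Y \<inter> C i) \<ge> 2" if "Y \<inter> C i \<inter> (entry i \<union> exit i) \<noteq> {}"
    using that entry_exit_shared[OF i] swap.shared_vertex_side_ge_2[OF i] by blast
qed

text \<open>
  Sorting the vertices by their first block and then by their level in it agrees, on the edges of
  every block, with the levels of that block: the only vertex of \<open>C i\<close> that is placed with an
  earlier block is the entry of \<open>C i\<close>, which lies below all its neighbours in \<open>C i\<close> anyway.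
\<close>

lemma optimal_ordering_exists: "\<exists>\<sigma>. ordering G \<sigma> \<and> ordering_imbalance \<sigma> G = chain_optimum"
proof -
  obtain r where r: "\<And>i. i \<in> {1..n} \<Longrightarrow> optimal_levels (r i) (X \<inter> C i) (Y \<inter> C i) (entry i) (exit i)"
    using optimal_block_levels by metis
  have r_less: "r i v < 5" if "i \<in> {1..n}" for i v
    using r[OF that] by (simp add: optimal_levels_def)
  have r_edge: "r i u \<noteq> r i v \<and> (u \<in> entry i \<or> v \<in> exit i \<longrightarrow> r i u < r i v)"
    if "i \<in> {1..n}" "u \<in> C i" "v \<in> C i" "u \<rightarrow>\<^bsub>G\<^esub> v" for i u v
    using edge_sides[OF that(4)]
  proof
    assume "u \<in> X \<and> v \<in> Y"
    then show ?thesis using r[OF that(1)] that(2,3) unfolding optimal_levels_def by blast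
  next
    assume "u \<in> Y \<and> v \<in> X"
    then show ?thesis using r[OF that(1)] that(2,3) unfolding optimal_levels_def by (metis IntI)
  qed
  define first where "first v = (LEAST i. i \<in> {1..n} \<and> v \<in> C i)" for v
  have first: "first v = i \<or> i \<noteq> 1 \<and> v \<in> entry i \<and> first v = i - 1" if "i \<in> {1..n}" "v \<in> C i" for i v
  proof -
    have 1: "first v \<in> {1..n} \<and> v \<in> C (first v)"
      unfolding first_def by (rule LeastI[of _ i]) (use that in blast)
    have "first v \<le> i" unfolding first_def by (rule Least_le) (use that in blast)
    then consider "first v = i" | "first v < i" by linarith
    then show ?thesis
    proof cases
      case 2
      then show ?thesis using block_interE[of "first v" i v] 1 that by (auto simp: entry_def)
    qed simp
  qed
  define f where "f v = 5 * first v + r (first v) v" for v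
  obtain \<sigma> where \<sigma>: "ordering G \<sigma>" and mono: "\<And>u v. u \<in> verts G \<Longrightarrow> v \<in> verts G \<Longrightarrow> f u < f v \<Longrightarrow> \<sigma> u < \<sigma> v"
    using ordering_refining_levels[OF finite_verts, of f] by blast
  have less: "\<sigma> u < \<sigma> v" if i: "i \<in> {1..n}" and uv: "u \<in> C i" "v \<in> C i" "u \<rightarrow>\<^bsub>G\<^esub> v" and lt: "r i u < r i v" for i u v
  proof -
    have "v \<notin> entry i" using r_edge[OF i uv(2,1) dominates_sym[OF uv(3)]] lt by auto
    then have v: "first v = i" using first[OF i uv(2)] by blast
    have "f u < f v"
    proof (cases "first u = i")
      case True
      then show ?thesis using v lt by (simp add: f_def)
    next
      case False
      then have "i \<noteq> 1" and u: "first u = i - 1" using first[OF i uv(1)] by auto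
      then have "i - 1 \<in> {1..n}" using i by auto
      from r_less[OF this, of u] this show ?thesis unfolding f_def u v by auto
    qed
    then show ?thesis using mono block_subset[OF i] uv by blast
  qed
  have less_iff: "\<sigma> u < \<sigma> v \<longleftrightarrow> r i u < r i v"
    if "i \<in> {1..n}" "u \<in> C i" "v \<in> C i" "u \<rightarrow>\<^bsub>G\<^esub> v" for i u v
    using less[OF that] less[OF that(1,3,2) dominates_sym[OF that(4)]] r_edge[OF that]
    by (metis less_asym nat_neq_iff)
  have "ordering_imbalance \<sigma> G = chain_optimum"
    unfolding chain_optimum_def ordering_imbalance_decomposition
  proof (intro arg_cong2[where f = "(+)"] sum.cong refl)
    fix i assume i: "i \<in> {1..n}"
    have "biclique_imbalance \<sigma> (X \<inter> C i) (Y \<inter> C i) = biclique_imbalance (r i) (X \<inter> C i) (Y \<inter> C i)"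
    proof (rule biclique_imbalance_cong)
      fix x y assume xy: "x \<in> X \<inter> C i" "y \<in> Y \<inter> C i"
      from block_complete[OF i xy] have "x \<rightarrow>\<^bsub>G\<^esub> y" "y \<rightarrow>\<^bsub>G\<^esub> x" using dominates_sym by blast+
      then show "(\<sigma> x < \<sigma> y \<longleftrightarrow> r i x < r i y) \<and> (\<sigma> y < \<sigma> x \<longleftrightarrow> r i y < r i x)"
        using less_iff[OF i] xy by blast
    qed
    also have "\<dots> = biclique_optimum (card (X \<inter> C i)) (card (Y \<inter> C i))"
      using r[OF i] by (simp add: optimal_levels_def)
    finally show "biclique_imbalance \<sigma> (X \<inter> C i) (Y \<inter> C i) = biclique_optimum (card (X \<inter> C i)) (card (Y \<inter> C i))" .
  next
    fix i assume i: "i \<in> {1..<n}"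
    let ?s = "link_vertex C i"
    have i1: "i \<in> {1..n}" and i2: "i + 1 \<in> {1..n}" using i by auto
    have "signed_imbalance \<sigma> (neighbours G ?s \<inter> C i) ?s = int (card (neighbours G ?s \<inter> C i))"
    proof (rule signed_imbalance_last)
      fix u assume "u \<in> neighbours G ?s \<inter> C i"
      then have u: "u \<in> C i" "u \<rightarrow>\<^bsub>G\<^esub> ?s" by (auto simp: neighbours_def dominates_sym)
      have "?s \<in> exit i" using i by (simp add: exit_def)
      then show "\<sigma> u < \<sigma> ?s"
        using r_edge[OF i1 u(1) link_in_blocks(1)[OF i] u(2)] less[OF i1 u(1) link_in_blocks(1)[OF i] u(2)] by blast
    qed
    moreover have "signed_imbalance \<sigma> (neighbours G ?s \<inter> C (i + 1)) ?s = - int (card (neighbours G ?s \<inter> C (i + 1)))"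
    proof (rule signed_imbalance_first)
      fix u assume "u \<in> neighbours G ?s \<inter> C (i + 1)"
      then have u: "u \<in> C (i + 1)" "?s \<rightarrow>\<^bsub>G\<^esub> u" by (auto simp: neighbours_def)
      have "?s \<in> entry (i + 1)" using i by (simp add: entry_def)
      then show "\<sigma> ?s < \<sigma> u"
        using r_edge[OF i2 link_in_blocks(2)[OF i] u] less[OF i2 link_in_blocks(2)[OF i] u] by blast
    qed
    ultimately show "\<bar>signed_imbalance \<sigma> (neighbours G ?s \<inter> C i) ?s + signed_imbalance \<sigma> (neighbours G ?s \<inter> C (i + 1)) ?s\<bar>
        - \<bar>signed_imbalance \<sigma> (neighbours G ?s \<inter> C i) ?s\<bar>
        - \<bar>signed_imbalance \<sigma> (neighbours G ?s \<inter> C (i + 1)) ?s\<bar>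
      = \<bar>int (degree_into G ?s (C i)) - int (degree_into G ?s (C (i + 1)))\<bar>
        - int (degree_into G ?s (C i)) - int (degree_into G ?s (C (i + 1)))"
      by (simp add: degree_into_def)
  qed
  with \<sigma> show ?thesis by blast
qed

lemma imbalance_eq_chain_optimum: "imbalance G = chain_optimum"
  unfolding imbalance_def
proof (rule Min_eqI[OF finite_ordering_imbalances])
  show "chain_optimum \<in> {ordering_imbalance \<sigma> G |\<sigma>. ordering G \<sigma>}"
    using optimal_ordering_exists by (metis (mono_tags, lifting) mem_Collect_eq)
qed (use ordering_imbalance_ge in auto)

end

theorem theorem2:
  fixes G :: "('a,'b) pre_digraph" and X Y :: "'a set" and \<C> :: "'a set set"
    and n :: nat and C :: "nat \<Rightarrow> 'a set"
  assumes "graph G" and "Digraph_Component.connected G"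
    and "chained_complete_bipartite G X Y \<C> n C"
  defines "s \<equiv> link_vertex C" and "g \<equiv> degree_into G"
  shows "imbalance G =
      (\<Sum>i=1..n. int (card (X \<inter> C i) * card (Y \<inter> C i)
                  + (card (X \<inter> C i) mod 2) * (card (Y \<inter> C i) mod 2)))
    - (\<Sum>i=1..<n. int (g (s i) (C i) + g (s i) (C (i + 1))))
    + (\<Sum>i=1..<n. \<bar>int (g (s i) (C i)) - int (g (s i) (C (i + 1)))\<bar>)"
proof -
  interpret graph G by fact
  interpret chained_bipartite_graph G X Y \<C> n C
    using assms(2,3) by unfold_locales
  show ?thesis
    unfolding imbalance_eq_chain_optimum chain_optimum_def biclique_optimum_def s_def g_def
    by (simp add: sum_subtractf sum.distrib)
qed

end
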